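(* Consider the Round-Robin protocol with $n$ agents over a finite item set $M$, as described in the context. Let $i\in[n]$ be an agent whose objective $f_i$ is normalized, nonnegative, monotone (non-decreasing) and submodular, and whose constraint $\mathcal{I}_i$ is a $p_i$-system. If agent $i$ follows the greedy policy (and the other agents follow arbitrary policies), then the set $S_i$ agent $i$ builds satisfies $f_i(S_i)\ge \mathrm{OPT}^-_i/(n+p_i)$.
   Context: Items: a finite set $M$ with $|M|=m$; agents $[n]=\{1,\dots,n\}$. For $f:2^M\to\mathbb{R}$ write $f(T\,|\,S)=f(T\cup S)-f(S)$ and $f(x\,|\,S)=f(\{x\}\,|\,S)$. $f$ is submodular if $f(x\,|\,S)\ge f(x\,|\,T)$ for all $S\subseteq T\subseteq M$, $x\notin T$. An independence system is a family $\mathcal{I}\subseteq 2^M$ with $\emptyset\in\mathcal{I}$ that is closed under taking subsets. A basis of $S\subseteq M$ is a maximal member of $\mathcal{I}$ contained in $S$; $\mathrm{ur}(S)$ and $\mathrm{lr}(S)$ are the largest and smallest cardinalities of a basis of $S$. A $p$-system is an independence system with $\max_{S\subseteq M}\mathrm{ur}(S)/\mathrm{lr}(S)\le p$. Round-Robin protocol: initially the set of available items is $Q=M$; for rounds $r=1,\dots,\lceil m/n\rceil$ and, within each round, for agents $i=1,\dots,n$ in this order, the current agent (according to its policy, which may depend on full information about all agents' objectives, constraints and choices so far) either selects one item of $Q$, which is then removed from $Q$, or selects nothing. Greedy policy of agent $i$: the agent maintains a set $S_i$ (initially $\emptyset$); at each of its turns, let $A=\{x\in Q: S_i\cup\{x\}\in\mathcal{I}_i\}$;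 if $A\ne\emptyset$, it selects some $j\in\arg\max_{x\in A} f_i(x\,|\,S_i)$ and adds $j$ to $S_i$; otherwise it selects nothing. Let $M_i$ be the set of items still available right before agent $i$'s first turn; $\mathrm{OPT}^-_i=\max\{f_i(S): S\in\mathcal{I}_i,\ S\subseteq M_i\}$. *)

theory Defs
  imports Complex_Main
begin

definition marginal :: "('a set \<Rightarrow> real) \<Rightarrow> 'a set \<Rightarrow> 'a set \<Rightarrow> real" where
  "marginal f T S = f (T \<union> S) - f S"

definition normalized :: "('a set \<Rightarrow> real) \<Rightarrow> bool" where
  "normalized f \<longleftrightarrow> f {} = 0"

definition nonneg_on :: "'a set \<Rightarrow> ('a set \<Rightarrow> real) \<Rightarrow> bool" where
  "nonneg_on M f \<longleftrightarrow> (\<forall>S. S \<subseteq> M \<longrightarrow> 0 \<le> f S)"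

definition submodular_on :: "'a set \<Rightarrow> ('a set \<Rightarrow> real) \<Rightarrow> bool" where
  "submodular_on M f \<longleftrightarrow>
     (\<forall>S T. S \<subseteq> T \<and> T \<subseteq> M \<longrightarrow> (\<forall>x\<in>M - T. marginal f {x} S \<ge> marginal f {x} T))"

definition independence_system :: "'a set \<Rightarrow> 'a set set \<Rightarrow> bool" where
  "independence_system M I \<longleftrightarrow>
     I \<subseteq> Pow M \<and> {} \<in> I \<and> (\<forall>S\<in>I. \<forall>T. T \<subseteq> S \<longrightarrow> T \<in> I)"

definition bases :: "'a set set \<Rightarrow> 'a set \<Rightarrow> 'a set set" where
  "bases I S = {B \<in> I. B \<subseteq> S \<and> (\<forall>C\<in>I. B \<subseteq> C \<and> C \<subseteq> S \<longrightarrow> C = B)}"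

definition upper_rank :: "'a set set \<Rightarrow> 'a set \<Rightarrow> nat" where
  "upper_rank I S = Max (card ` bases I S)"

definition lower_rank :: "'a set set \<Rightarrow> 'a set \<Rightarrow> nat" where
  "lower_rank I S = Min (card ` bases I S)"

text \<open>
  If the lower rank of \<open>S\<close> is \<open>0\<close>, then the empty set is its only basis and the upper rank is \<open>0\<close>
  as well. The quotient is then \<open>0 / 0 = 0\<close>, so such sets (for instance \<open>S = {}\<close>) impose no
  condition beyond \<open>p \<ge> 0\<close>.
\<close>
definition p_system :: "'a set \<Rightarrow> 'a set set \<Rightarrow> real \<Rightarrow> bool" where
  "p_system M I p \<longleftrightarrow> independence_system M I \<and>
     Max ((\<lambda>S. real (upper_rank I S) / real (lower_rank I S)) ` Pow M) \<le> p"

text \<open>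
  A history lists the turns played so far, oldest first: the agent whose turn it was and the item
  selected (\<open>None\<close> if nothing was selected). A policy maps the history to the next choice; its
  dependence on the objectives and constraints of all agents is implicit, since these are fixed
  during a run.
\<close>
type_synonym 'a history = "(nat \<times> 'a option) list"

type_synonym 'a policy = "'a history \<Rightarrow> 'a option"

definition available :: "'a set \<Rightarrow> 'a history \<Rightarrow> 'a set" where
  "available M h = {x \<in> M. \<forall>j. (j, Some x) \<notin> set h}"

definition selected :: "nat \<Rightarrow> 'a history \<Rightarrow> 'a set" where
  "selected i h = {x. (i, Some x) \<in> set h}"

definition legal_policy :: "'a set \<Rightarrow> 'a policy \<Rightarrow> bool" where
  "legal_policy M \<sigma> \<longleftrightarrow> (\<forall>h x. \<sigma> h = Some x \<longrightarrow> x \<in> available M h)"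

text \<open>Ties between maximisers are broken arbitrarily, hence a predicate and not one policy.\<close>
definition greedy_policy ::
  "'a set \<Rightarrow> ('a set \<Rightarrow> real) \<Rightarrow> 'a set set \<Rightarrow> nat \<Rightarrow> 'a policy \<Rightarrow> bool" where
  "greedy_policy M f I i \<sigma> \<longleftrightarrow>
     (\<forall>h. let S = selected i h; A = {x \<in> available M h. S \<union> {x} \<in> I} in
        if A \<noteq> {}
        then \<exists>j. is_arg_max (\<lambda>x. marginal f {x} S) (\<lambda>x. x \<in> A) j \<and> \<sigma> h = Some j
        else \<sigma> h = None)"

definition play :: "(nat \<Rightarrow> 'a policy) \<Rightarrow> nat list \<Rightarrow> 'a history" where
  "play \<sigma> agents = foldl (\<lambda>h i. h @ [(i, \<sigma> i h)]) [] agents"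

definition round_robin :: "'a set \<Rightarrow> nat \<Rightarrow> (nat \<Rightarrow> 'a policy) \<Rightarrow> 'a history" where
  "round_robin M n \<sigma> =
     play \<sigma> (concat (replicate (nat \<lceil>real (card M) / real n\<rceil>) [1..<n + 1]))"

text \<open>Only agents \<open>1, \<dots>, i - 1\<close> move before the first turn of agent \<open>i\<close>.\<close>
definition available_at_first_turn :: "'a set \<Rightarrow> (nat \<Rightarrow> 'a policy) \<Rightarrow> nat \<Rightarrow> 'a set" where
  "available_at_first_turn M \<sigma> i = available M (play \<sigma> [1..<i])"

definition opt_minus ::
  "'a set \<Rightarrow> (nat \<Rightarrow> 'a policy) \<Rightarrow> ('a set \<Rightarrow> real) \<Rightarrow> 'a set set \<Rightarrow> nat \<Rightarrow> real" where
  "opt_minus M \<sigma> f I i = Max (f ` {S \<in> I. S \<subseteq> available_at_first_turn M \<sigma> i})"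

end

theory Submission
  imports Defs
begin

text \<open>
  Let \<open>S\<close> be the final set of agent \<open>i\<close>, \<open>O\<close> an optimal set and \<open>R\<close> the number of rounds. By
  monotonicity and submodularity \<open>f O\<close> exceeds \<open>f S\<close> by at most the sum of the marginals \<open>f(x | S)\<close>
  over \<open>x \<in> O - S\<close>. Before the turn of agent \<open>i\<close> with index \<open>k\<close> (counting from \<open>0\<close>), at most
  \<open>k (n - 1)\<close> of these items have been taken by other agents, and at most \<open>p k\<close> are blocked by the
  constraint, because the current set is a basis of its union with the blocked items. Every
  other item is a candidate of the greedy choice, so its marginal is at most the greedy gain of that
  turn. Greedy gains are nonincreasing, so charging the items in the order in which they are lost
  costs at most \<open>n - 1 + p\<close> times the sum of the gains, that is, \<open>(n - 1 + p) f S\<close>. Items that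
  survive all \<open>R\<close> rounds fit into the same budget because \<open>card O \<le> n R \<le> (n - 1 + p) R\<close>.
\<close>

section \<open>Charging along a decreasing chain of sets\<close>

text \<open>An item of \<open>X\<close> lost between turns \<open>k\<close> and \<open>k + 1\<close>
  still lies in \<open>A k\<close>, so its weight is at most \<open>\<delta> k\<close>. As
  \<open>\<delta>\<close> is nonincreasing, early losses cost most, and the extreme case allowed by
  \<open>lost\<close> is \<open>C\<close> items per turn. \<open>C\<close> is real because it will
  contain the parameter \<open>p\<close>.\<close>

lemma sum_le_prefix_charging:
  fixes w :: "'a \<Rightarrow> real" and \<delta> :: "nat \<Rightarrow> real" and C :: real
  assumes fin: "finite X"
    and anti: "\<And>k. A (Suc k) \<subseteq> A k"
    and dec: "\<And>k. \<delta> (Suc k) \<le> \<delta> k" and nonneg: "\<And>k. 0 \<le> \<delta> k"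
    and le: "\<And>k x. k < R \<Longrightarrow> x \<in> X \<inter> A k \<Longrightarrow> w x \<le> \<delta> k"
    and lost: "\<And>k. k < R \<Longrightarrow> real (card (X - A k)) \<le> C * real k"
    and total: "real (card X) \<le> C * real R"
  shows "sum w X \<le> C * (\<Sum>k<R. \<delta> k)"
proof (cases R)
  case 0
  with total fin show ?thesis by simp
next
  case (Suc m)
  have charge: "sum w Y \<le> sum w Z + (real (card Y) - real (card Z)) * \<delta> k"
    if "Z = X - A k" "Z \<subseteq> Y" "Y \<subseteq> X" "k < R" for Y Z k
  proof -
    have finY: "finite Y" using fin that finite_subset by blast
    have "sum w (Y - Z) \<le> real (card (Y - Z)) * \<delta> k"
      by (rule sum_bounded_above) (use le that in blast)
    moreover have "real (card (Y - Z)) = real (card Y) - real (card Z)"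
      using finY that by (metis card_Diff_subset card_mono finite_subset of_nat_diff)
    moreover have "sum w Y = sum w Z + sum w (Y - Z)"
      using finY that by (metis add.commute sum.subset_diff)
    ultimately show ?thesis by simp
  qed
  \<comment> \<open>The unused part of the budget is accounted at the current gain.\<close>
  have invariant: "sum w (X - A k) + (C * real k - real (card (X - A k))) * \<delta> k
      \<le> C * (\<Sum>j<k. \<delta> j)" if "k < R" for k
    using that
  proof (induction k)
    case 0
    have "card (X - A 0) = 0" using lost[of 0] 0 by simp
    then have "X - A 0 = {}" using fin by (metis card_0_eq finite_Diff)
    then show ?case unfolding \<open>X - A 0 = {}\<close> by simp
  next
    case (Suc k)
    let ?Z = "X - A k" and ?Y = "X - A (Suc k)"
    have "sum w ?Y \<le> sum w ?Z + (real (card ?Y) - real (card ?Z)) * \<delta> k"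
      by (rule charge) (use anti Suc.prems in auto)
    moreover have "(C * real (Suc k) - real (card ?Y)) * \<delta> (Suc k)
        \<le> (C * real (Suc k) - real (card ?Y)) * \<delta> k"
      using lost[of "Suc k"] Suc.prems dec by (intro mult_left_mono) auto
    ultimately show ?case
      using Suc.IH Suc.prems by (simp add: algebra_simps)
  qed
  \<comment> \<open>At the last turn \<open>m = R - 1\<close> all items not yet lost are charged at
    \<open>\<delta> m\<close>, whether or not they survive that turn; \<open>total\<close> bounds
    their number.\<close>
  have "sum w X \<le> sum w (X - A m) + (real (card X) - real (card (X - A m))) * \<delta> m"
    by (rule charge) (use Suc in auto)
  also have "\<dots> \<le> sum w (X - A m) + (C * real R - real (card (X - A m))) * \<delta> m"
    using total nonneg by (intro add_left_mono mult_right_mono) auto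
  also have "\<dots> \<le> C * (\<Sum>k<R. \<delta> k)"
    using invariant[of m] Suc by (simp add: algebra_simps)
  finally show ?thesis .
qed

section \<open>Submodular functions and ranks in p-systems\<close>

lemma submodular_union_bound:
  assumes "finite M" "submodular_on M f" "S \<subseteq> M" "X \<subseteq> M" "X \<inter> S = {}"
  shows "f (S \<union> X) \<le> f S + (\<Sum>x\<in>X. marginal f {x} S)"
proof -
  have "finite X" using assms finite_subset by blast
  then show ?thesis using assms(4,5)
  proof (induction X rule: finite_induct)
    case (insert x X)
    have "marginal f {x} (S \<union> X) \<le> marginal f {x} S"
    proof -
      have "S \<subseteq> S \<union> X" "S \<union> X \<subseteq> M" "x \<in> M - (S \<union> X)"
        using assms(3) insert.prems insert.hyps by auto
      then show ?thesis using assms(2) by (simp add: submodular_on_def)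
    qed
    moreover have "f (S \<union> insert x X) = f (S \<union> X) + marginal f {x} (S \<union> X)"
      by (simp add: marginal_def)
    ultimately show ?case using insert by auto
  qed simp
qed

lemma extends_to_basis:
  assumes "finite W" "Y \<in> I" "Y \<subseteq> W"
  obtains B where "B \<in> bases I W" "Y \<subseteq> B"
proof -
  let ?E = "{C \<in> I. Y \<subseteq> C \<and> C \<subseteq> W}"
  have "?E \<subseteq> Pow W" by blast
  then have "finite ?E" using assms(1) finite_subset by blast
  moreover have "?E \<noteq> {}" using assms by blast
  ultimately obtain B where B: "B \<in> ?E" "\<forall>D\<in>?E. B \<subseteq> D \<longrightarrow> B = D"
    using finite_has_maximal[of ?E] by blast
  have "C = B" if "C \<in> I" "B \<subseteq> C" "C \<subseteq> W" for C using B that by blast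
  then have "B \<in> bases I W" using B(1) by (simp add: bases_def)
  then show thesis by (rule that) (use B(1) in simp)
qed

lemma p_system_rank_ratio:
  assumes "finite M" "p_system M I p" "W \<subseteq> M"
  shows "real (upper_rank I W) / real (lower_rank I W) \<le> p"
proof -
  let ?r = "\<lambda>S. real (upper_rank I S) / real (lower_rank I S)"
  have "?r W \<le> Max (?r ` Pow M)" using assms by (intro Max_ge) auto
  also have "\<dots> \<le> p" using assms(2) unfolding p_system_def by blast
  finally show ?thesis .
qed

lemma p_system_nonneg:
  assumes "finite M" "p_system M I p"
  shows "0 \<le> p"
proof -
  have "0 \<le> real (upper_rank I {}) / real (lower_rank I {})" by simp
  also have "\<dots> \<le> p" by (rule p_system_rank_ratio[OF assms]) simp
  finally show ?thesis .
qed

text \<open>\<open>S\<close> is a basis of \<open>S \<union> Y\<close>, since no item of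
  \<open>Y\<close> extends it, while \<open>Y\<close> lies in some basis of the same set. Hence
  \<open>card Y\<close> is at most the upper rank, and the lower rank is at most
  \<open>card S\<close>.\<close>

lemma p_system_blocked:
  assumes fin: "finite M" and sys: "p_system M I p"
    and "S \<in> I" "Y \<in> I" and blocked: "\<And>x. x \<in> Y \<Longrightarrow> insert x S \<notin> I"
  shows "real (card Y) \<le> p * real (card S)"
proof -
  let ?W = "S \<union> Y"
  have indep: "I \<subseteq> Pow M" "\<And>S T. S \<in> I \<Longrightarrow> T \<subseteq> S \<Longrightarrow> T \<in> I"
    using sys unfolding p_system_def independence_system_def by blast+
  have WM: "?W \<subseteq> M" using indep assms by blast
  have finW: "finite ?W" using WM fin finite_subset by blast
  have fin_bases: "finite (bases I ?W)"
    by (rule finite_subset[of _ "Pow ?W"]) (use finW in \<open>unfold bases_def, blast, simp\<close>)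
  have S: "S \<in> bases I ?W"
  proof -
    have "C = S" if C: "C \<in> I" "S \<subseteq> C" "C \<subseteq> ?W" for C
    proof (rule ccontr)
      assume "C \<noteq> S"
      then obtain x where "x \<in> C" "x \<notin> S" using C by blast
      then have "x \<in> Y" "insert x S \<subseteq> C" using C by auto
      then show False using blocked indep C by blast
    qed
    then show ?thesis using \<open>S \<in> I\<close> unfolding bases_def by blast
  qed
  obtain B where B: "B \<in> bases I ?W" "Y \<subseteq> B"
    using extends_to_basis[OF finW \<open>Y \<in> I\<close>] by blast
  have "finite B" using B finW finite_subset unfolding bases_def by blast
  then have "card Y \<le> card B" using B card_mono by blast
  also have "card B \<le> upper_rank I ?W"
    unfolding upper_rank_def using B fin_bases by simp
  finally have up: "card Y \<le> upper_rank I ?W" .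
  have low: "lower_rank I ?W \<le> card S"
    unfolding lower_rank_def using S fin_bases by simp
  have ratio: "real (upper_rank I ?W) / real (lower_rank I ?W) \<le> p"
    by (rule p_system_rank_ratio[OF fin sys WM])
  have p: "0 \<le> p" by (rule p_system_nonneg[OF fin sys])
  show ?thesis
  proof (cases "lower_rank I ?W = 0")
    \<comment> \<open>Division by zero makes the ratio bound vacuous here. Instead,
      \<open>{}\<close> is a basis, hence maximal, which forces \<open>Y = {}\<close>.\<close>
    case True
    then have "0 \<in> card ` bases I ?W"
      using Min_in[of "card ` bases I ?W"] S fin_bases unfolding lower_rank_def by auto
    then obtain D where "D \<in> bases I ?W" "card D = 0" by (metis imageE)
    moreover from this have "D = {}"
      using finW finite_subset unfolding bases_def by fastforce
    ultimately have "Y = {}" using \<open>Y \<in> I\<close> unfolding bases_def by blast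
    then show ?thesis using p by simp
  next
    case False
    have "real (card Y) \<le> real (upper_rank I ?W)" using up by simp
    also have "\<dots> \<le> p * real (lower_rank I ?W)"
      using ratio False by (simp add: divide_simps)
    also have "\<dots> \<le> p * real (card S)" using low p by (intro mult_left_mono) auto
    finally show ?thesis .
  qed
qed

text \<open>An independent singleton is its own only basis, so its rank ratio is \<open>1\<close>.
  This lets the items that are never lost fit into the charging budget.\<close>

lemma p_system_ge_one:
  assumes "finite M" "p_system M I p" "{x} \<in> I"
  shows "1 \<le> p"
proof -
  have "bases I {x} = {{x}}"
    using assms(3) by (auto simp: bases_def)
  then show ?thesis
    using p_system_rank_ratio[OF assms(1,2), of "{x}"] assms
    by (auto simp: upper_rank_def lower_rank_def p_system_def independence_system_def)
qed

section \<open>Greedy sequences with competing removals\<close>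

text \<open>Separates the greedy analysis from the protocol: \<open>S k\<close> and
  \<open>Q k\<close> are the agent's set and the available items before turn \<open>k\<close>, and
  \<open>c * k\<close> bounds the items of \<open>T - S R\<close> that others have taken by then.
  Both sequences continue past \<open>R\<close>, so the facts about gains need no bound on the
  index.\<close>

lemma greedy_sequence_bound:
  fixes f :: "'a set \<Rightarrow> real" and I :: "'a set set" and S Q :: "nat \<Rightarrow> 'a set" and c R :: nat
  defines "A \<equiv> \<lambda>k. {x \<in> Q k. insert x (S k) \<in> I}"
  assumes fin: "finite M" and norm: "normalized f" and mono: "mono_on (Pow M) f"
    and sub: "submodular_on M f" and sys: "p_system M I p"
    and S0: "S 0 = {}" and QM: "Q 0 \<subseteq> M" and Q_anti: "\<And>k. Q (Suc k) \<subseteq> Q k"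
    and stop: "\<And>k. A k = {} \<Longrightarrow> S (Suc k) = S k"
    and step: "\<And>k. A k \<noteq> {} \<Longrightarrow> \<exists>g\<in>A k. S (Suc k) = insert g (S k) \<and>
                 (\<forall>x\<in>A k. f (insert x (S k)) \<le> f (insert g (S k)))"
    and opt: "T \<in> I" "T \<subseteq> Q 0"
    and lost: "\<And>k. k < R \<Longrightarrow> card (T - S R - Q k) \<le> c * k"
    and rounds: "card M \<le> (c + 1) * R"
  shows "f T \<le> (real (c + 1) + p) * f (S R)"
proof -
  have indep: "I \<subseteq> Pow M" "{} \<in> I" "\<And>U V. U \<in> I \<Longrightarrow> V \<subseteq> U \<Longrightarrow> V \<in> I"
    using sys unfolding p_system_def independence_system_def by blast+
  have SI: "S k \<in> I" for k
  proof (induction k)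
    case 0
    then show ?case using S0 indep by simp
  next
    case (Suc k)
    then show ?case using stop[of k] step[of k] by (cases "A k = {}") (auto simp: A_def)
  qed
  have SM: "S k \<subseteq> M" for k using SI indep by blast
  have S_Suc: "S k \<subseteq> S (Suc k)" for k using stop[of k] step[of k] by (cases "A k = {}") auto
  have S_mono: "S k \<subseteq> S l" if "k \<le> l" for k l using S_Suc that by (rule lift_Suc_mono_le)
  have Q_mono: "Q l \<subseteq> Q k" if "k \<le> l" for k l using Q_anti that by (rule lift_Suc_antimono_le)
  have QM': "Q k \<subseteq> M" for k using Q_mono[of 0 k] QM by simp
  have A_anti: "A (Suc k) \<subseteq> A k" for k
    unfolding A_def using Q_anti[of k] S_Suc[of k] indep(3)[OF _ insert_mono[OF S_Suc[of k]]] by blast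
  have card_S: "card (S k) \<le> k" for k
  proof (induction k)
    case (Suc k)
    then show ?case
      using stop[of k] step[of k] finite_subset[OF SM fin, of k]
      by (cases "A k = {}") (auto simp: card_insert_if split: if_splits)
  qed (simp add: S0)
  define \<delta> where "\<delta> k = f (S (Suc k)) - f (S k)" for k
  have nonneg: "0 \<le> \<delta> k" for k
    unfolding \<delta>_def using mono_onD[OF mono _ _ S_Suc] SM by simp
  have greedy: "marginal f {x} (S k) \<le> \<delta> k" if "x \<in> A k" for x k
  proof -
    from that have "A k \<noteq> {}" by blast
    from step[OF this] that show ?thesis by (auto simp: marginal_def \<delta>_def)
  qed
  \<comment> \<open>The definition of submodularity only covers items outside the larger set. For
    \<open>x \<in> S l\<close> the later marginal is \<open>0\<close>, and monotonicity makes the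
    earlier one nonnegative.\<close>
  have marginal_anti: "marginal f {x} (S l) \<le> marginal f {x} (S k)" if "k \<le> l" "x \<in> M" for x k l
  proof (cases "x \<in> S l")
    case True
    then have "marginal f {x} (S l) = 0" by (simp add: marginal_def insert_absorb)
    moreover have "f (S k) \<le> f (insert x (S k))"
      using SM that by (intro mono_onD[OF mono]) auto
    ultimately show ?thesis by (simp add: marginal_def)
  next
    case False
    then show ?thesis using sub S_mono[OF that(1)] SM that(2)
      unfolding submodular_on_def by blast
  qed
  \<comment> \<open>The item chosen at turn \<open>k + 1\<close> was already a candidate at turn
    \<open>k\<close>, where its marginal was at least as large. Without a candidate the gain is
    \<open>0\<close>.\<close>
  have dec: "\<delta> (Suc k) \<le> \<delta> k" for k
  proof (cases "A (Suc k) = {}")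
    case True
    then show ?thesis using stop[of "Suc k"] nonneg[of k] by (simp add: \<delta>_def)
  next
    case False
    then obtain g where g: "g \<in> A (Suc k)" "S (Suc (Suc k)) = insert g (S (Suc k))"
      using step by blast
    then have "\<delta> (Suc k) = marginal f {g} (S (Suc k))" by (simp add: \<delta>_def marginal_def)
    also have "\<dots> \<le> marginal f {g} (S k)"
      using g(1) QM' by (intro marginal_anti) (auto simp: A_def)
    also have "\<dots> \<le> \<delta> k" using greedy A_anti g by blast
    finally show ?thesis .
  qed
  define X where "X = T - S R"
  have XM: "X \<subseteq> M" using opt QM by (auto simp: X_def)
  have finX: "finite X" using XM fin finite_subset by blast
  have XI: "Y \<in> I" if "Y \<subseteq> X" for Y using that indep(3)[OF opt(1)] by (auto simp: X_def)
  have "(\<Sum>x\<in>X. marginal f {x} (S R)) \<le> (real c + p) * (\<Sum>k<R. \<delta> k)"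
  \<comment> \<open>The bound \<open>1 \<le> p\<close> needs an independent singleton, which a
    nonempty \<open>X\<close> supplies; for empty \<open>X\<close> the bound
    \<open>0 \<le> p\<close> suffices.\<close>
  proof (cases "X = {}")
    case True
    have "0 \<le> (real c + p) * (\<Sum>k<R. \<delta> k)"
      using p_system_nonneg[OF fin sys] nonneg by (intro mult_nonneg_nonneg sum_nonneg) auto
    then show ?thesis using True by simp
  next
    case False
    have le: "marginal f {x} (S R) \<le> \<delta> k" if "k < R" "x \<in> X \<inter> A k" for k x
      using greedy[of x k] marginal_anti[of k R x] that XM by auto
    show ?thesis
    proof (rule sum_le_prefix_charging[where A = A])
      fix k assume "k < R"
      \<comment> \<open>An item outside \<open>A k\<close> is either taken or blocked by the
        constraint; \<open>?B\<close> collects the blocked ones.\<close>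
      let ?B = "{x \<in> X. insert x (S k) \<notin> I}"
      have "X - A k \<subseteq> (X - Q k) \<union> ?B" by (auto simp: A_def)
      then have "card (X - A k) \<le> card ((X - Q k) \<union> ?B)"
        using finX by (intro card_mono) auto
      then have "card (X - A k) \<le> card (X - Q k) + card ?B"
        by (rule order_trans) (rule card_Un_le)
      moreover have "card (X - Q k) \<le> c * k" using lost[OF \<open>k < R\<close>] by (simp add: X_def)
      moreover have "real (card ?B) \<le> p * real (card (S k))"
        using XI by (intro p_system_blocked[OF fin sys SI]) auto
      moreover have "p * real (card (S k)) \<le> p * real k"
        using card_S p_system_nonneg[OF fin sys] by (intro mult_left_mono) auto
      ultimately show "real (card (X - A k)) \<le> (real c + p) * real k"
        by (simp add: algebra_simps flip: of_nat_mult of_nat_add)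
    next
      obtain x where "x \<in> X" using False by blast
      then have p: "1 \<le> p" using XI by (intro p_system_ge_one[OF fin sys]) auto
      have "real (card X) \<le> real ((c + 1) * R)"
        using card_mono[OF fin XM] rounds by linarith
      also have "\<dots> = (real c + 1) * real R" by (simp add: algebra_simps)
      also have "\<dots> \<le> (real c + p) * real R" using p by (intro mult_right_mono) auto
      finally show "real (card X) \<le> (real c + p) * real R" .
    qed (use finX A_anti dec nonneg le in auto)
  qed
  also have "(\<Sum>k<R. \<delta> k) = f (S R)"
    unfolding \<delta>_def using norm S0
      sum_lessThan_telescope[of "\<lambda>k. f (S k)" R] by (simp add: normalized_def)
  finally have "f (S R \<union> X) \<le> f (S R) + (real c + p) * f (S R)"
    using submodular_union_bound[OF fin sub SM XM, of R] by (simp add: X_def Diff_Int_distrib2)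
  moreover have "f T \<le> f (S R \<union> X)"
    using SM XM opt QM by (intro mono_onD[OF mono]) (auto simp: X_def)
  ultimately show ?thesis by (simp add: algebra_simps)
qed

section \<open>Histories of the Round-Robin protocol\<close>

lemma play_append:
  obtains t where "play \<sigma> (xs @ ys) = play \<sigma> xs @ t" "map fst t = ys"
proof -
  have "\<exists>t. play \<sigma> (xs @ ys) = play \<sigma> xs @ t \<and> map fst t = ys"
  proof (induction ys rule: rev_induct)
    case (snoc y ys)
    then obtain t where t: "play \<sigma> (xs @ ys) = play \<sigma> xs @ t" "map fst t = ys" by blast
    have "play \<sigma> (xs @ ys @ [y]) = play \<sigma> (xs @ ys) @ [(y, \<sigma> y (play \<sigma> (xs @ ys)))]"
      by (simp add: play_def)
    then show ?case using t by (intro exI[of _ "t @ [(y, \<sigma> y (play \<sigma> (xs @ ys)))]"]) simp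
  qed simp
  then show thesis using that by blast
qed

lemma selected_append: "selected i (g @ h) = selected i g \<union> selected i h"
  by (auto simp: selected_def)

lemma selected_eq_empty: "i \<notin> fst ` set h \<Longrightarrow> selected i h = {}"
  by (force simp: selected_def)

text \<open>Turns of agent \<open>i\<close> are counted from \<open>0\<close>. The history is
  defined for every \<open>k\<close>, also beyond the last round of the protocol, which yields the
  infinite sequences of the greedy analysis.\<close>

definition history_before_turn :: "(nat \<Rightarrow> 'a policy) \<Rightarrow> nat \<Rightarrow> nat \<Rightarrow> nat \<Rightarrow> 'a history" where
  "history_before_turn \<sigma> n i k = play \<sigma> (concat (replicate k [1..<n + 1]) @ [1..<i])"

text \<open>Between two consecutive turns of \<open>i\<close> come \<open>i + 1, ..., n\<close> and
  then \<open>1, ..., i - 1\<close>: a rotated round without \<open>i\<close>.\<close>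

lemma history_before_turn_Suc:
  assumes "i \<in> {1..n}"
  obtains t where
    "history_before_turn \<sigma> n i (Suc k) =
       history_before_turn \<sigma> n i k @ (i, \<sigma> i (history_before_turn \<sigma> n i k)) # t"
    "length t = n - 1" "i \<notin> fst ` set t"
proof -
  let ?L = "concat (replicate k [1..<n + 1]) @ [1..<i]" and ?ys = "[i + 1..<n + 1] @ [1..<i]"
  have "[1..<n + 1] = [1..<i] @ i # [i + 1..<n + 1]"
    using assms upt_add_eq_append[of 1 i "n + 1 - i"] upt_conv_Cons[of i "n + 1"] by simp
  moreover have "concat (replicate (Suc k) [1..<n + 1]) = concat (replicate k [1..<n + 1]) @ [1..<n + 1]"
    by (simp flip: replicate_append_same)
  ultimately have eq: "concat (replicate (Suc k) [1..<n + 1]) @ [1..<i] = (?L @ [i]) @ ?ys" by simp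
  obtain t where t: "play \<sigma> ((?L @ [i]) @ ?ys) = play \<sigma> (?L @ [i]) @ t" "map fst t = ?ys"
    by (rule play_append)
  have last: "play \<sigma> (?L @ [i]) = play \<sigma> ?L @ [(i, \<sigma> i (play \<sigma> ?L))]"
    by (simp add: play_def)
  show thesis
  proof (rule that)
    show "history_before_turn \<sigma> n i (Suc k) =
       history_before_turn \<sigma> n i k @ (i, \<sigma> i (history_before_turn \<sigma> n i k)) # t"
      unfolding history_before_turn_def eq t(1) last by simp
    have "length t = length ?ys" using t(2) by (metis length_map)
    then show "length t = n - 1" using assms by (simp del: upt_Suc)
    have "fst ` set t = set ?ys" using t(2) by (metis list.set_map)
    then show "i \<notin> fst ` set t" by simp
  qed
qed

text \<open>The history on the right also contains turns of agents \<open>1, ..., i - 1\<close> in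
  one further round. These leave the selection of \<open>i\<close> unchanged.\<close>

lemma selected_round_robin:
  "selected i (round_robin M n \<sigma>) =
     selected i (history_before_turn \<sigma> n i (nat \<lceil>real (card M) / real n\<rceil>))"
proof -
  let ?L = "concat (replicate (nat \<lceil>real (card M) / real n\<rceil>) [1..<n + 1])"
  obtain t where t: "play \<sigma> (?L @ [1..<i]) = play \<sigma> ?L @ t" "map fst t = [1..<i]"
    by (rule play_append)
  have "fst ` set t = set [1..<i]" using t(2) by (metis list.set_map)
  then have "selected i t = {}" by (intro selected_eq_empty) simp
  then show ?thesis
    unfolding round_robin_def history_before_turn_def t(1) selected_append by simp
qed

text \<open>Each of the \<open>n - 1\<close> turns of other agents in a round removes at most one
  item, and the choices of \<open>i\<close> remove nothing from \<open>X\<close>, which avoids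
  them.\<close>

lemma card_taken_by_others:
  assumes "finite X" "i \<in> {1..n}" "X \<subseteq> available M (history_before_turn \<sigma> n i 0)"
    and "X \<inter> selected i (history_before_turn \<sigma> n i k) = {}"
  shows "card (X - available M (history_before_turn \<sigma> n i k)) \<le> (n - 1) * k"
  using assms(4)
proof (induction k)
  case 0
  have "X - available M (history_before_turn \<sigma> n i 0) = {}" using assms(3) by blast
  then show ?case by (metis card.empty le0)
next
  case (Suc k)
  let ?h = "history_before_turn \<sigma> n i"
  obtain t where t: "?h (Suc k) = ?h k @ (i, \<sigma> i (?h k)) # t" "length t = n - 1"
    by (rule history_before_turn_Suc[OF assms(2)])
  \<comment> \<open>For a turn without a selection, \<open>the None\<close> adds an unspecified
    item; this is harmless, as \<open>?Y\<close> still has at most one item per turn in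
    \<open>t\<close>.\<close>
  let ?Y = "(the \<circ> snd) ` set t"
  have disj: "X \<inter> selected i (?h k) = {}"
    using Suc.prems unfolding t(1) selected_append by blast
  have "X - available M (?h (Suc k)) \<subseteq> (X - available M (?h k)) \<union> ?Y"
  proof
    fix x assume x: "x \<in> X - available M (?h (Suc k))"
    then have "x \<in> M" using assms(3) by (auto simp: available_def)
    with x obtain j where j: "(j, Some x) \<in> set (?h (Suc k))" by (auto simp: available_def)
    show "x \<in> (X - available M (?h k)) \<union> ?Y"
    proof (cases "x \<in> available M (?h k)")
      case True
      have "(j, Some x) \<noteq> (i, \<sigma> i (?h k))"
        using Suc.prems x unfolding t(1) by (auto simp: selected_def)
      then have "(j, Some x) \<in> set t" using j True unfolding t(1) by (auto simp: available_def)
      then show ?thesis by force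
    qed (use x in simp)
  qed
  then have "card (X - available M (?h (Suc k))) \<le> card ((X - available M (?h k)) \<union> ?Y)"
    using assms(1) by (intro card_mono) auto
  also have "\<dots> \<le> card (X - available M (?h k)) + card ?Y" by (rule card_Un_le)
  also have "card ?Y \<le> n - 1"
    using card_image_le[of "set t"] card_length[of t] t(2) by (metis List.finite_set le_trans)
  finally show ?case using Suc.IH[OF disj] by simp
qed

section \<open>The approximation guarantee\<close>

theorem theorem2:
  fixes M :: "'a set" and n i :: nat
    and f :: "nat \<Rightarrow> 'a set \<Rightarrow> real" and \<I> :: "nat \<Rightarrow> 'a set set"
    and p :: "nat \<Rightarrow> real" and \<sigma> :: "nat \<Rightarrow> 'a policy"
  assumes "finite M"
    and "i \<in> {1..n}"
    and "normalized (f i)"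
    and "nonneg_on M (f i)"
    and "mono_on (Pow M) (f i)"
    and "submodular_on M (f i)"
    and "p_system M (\<I> i) (p i)"
    and "\<And>j. j \<in> {1..n} \<Longrightarrow> legal_policy M (\<sigma> j)"
    and "greedy_policy M (f i) (\<I> i) i (\<sigma> i)"
  shows "f i (selected i (round_robin M n \<sigma>))
           \<ge> opt_minus M \<sigma> (f i) (\<I> i) i / (real n + p i)"
proof -
  define R where "R = nat \<lceil>real (card M) / real n\<rceil>"
  define h where "h = history_before_turn \<sigma> n i"
  define S where "S k = selected i (h k)" for k
  define Q where "Q k = available M (h k)" for k
  define A where "A k = {x \<in> Q k. insert x (S k) \<in> \<I> i}" for k
  have n: "0 < n" using assms(2) by simp
  have indep: "\<I> i \<subseteq> Pow M" "{} \<in> \<I> i"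
    using assms(7) unfolding p_system_def independence_system_def by blast+
  have h0: "h 0 = play \<sigma> [1..<i]" by (simp add: h_def history_before_turn_def)
  obtain t where t: "play \<sigma> ([] @ [1..<i]) = play \<sigma> [] @ t" "map fst t = [1..<i]"
    by (rule play_append)
  have "h 0 = t" using t(1) unfolding h0 by (simp add: play_def)
  then have "fst ` set (h 0) = set [1..<i]" using t(2) by (metis list.set_map)
  then have S0: "S 0 = {}" unfolding S_def by (intro selected_eq_empty) simp
  have S_Suc: "S (Suc k) = S k \<union> set_option (\<sigma> i (h k))" and Q_anti: "Q (Suc k) \<subseteq> Q k" for k
  proof -
    obtain t where t: "h (Suc k) = h k @ (i, \<sigma> i (h k)) # t" "i \<notin> fst ` set t"
      using history_before_turn_Suc[OF assms(2)] unfolding h_def by metis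
    show "S (Suc k) = S k \<union> set_option (\<sigma> i (h k))"
      using t(2) unfolding S_def t(1) by (force simp: selected_def elem_set)
    show "Q (Suc k) \<subseteq> Q k" unfolding Q_def t(1) by (auto simp: available_def)
  qed
  have greedy: "if A k \<noteq> {}
      then \<exists>j. is_arg_max (\<lambda>x. marginal (f i) {x} (S k)) (\<lambda>x. x \<in> A k) j \<and> \<sigma> i (h k) = Some j
      else \<sigma> i (h k) = None" for k
  proof -
    have "A k = {x \<in> available M (h k). selected i (h k) \<union> {x} \<in> \<I> i}"
      by (simp add: A_def S_def Q_def)
    then show ?thesis
      using assms(9)[unfolded greedy_policy_def Let_def, rule_format, of "h k"]
      by (simp only: S_def)
  qed
  have finQ: "finite {T \<in> \<I> i. T \<subseteq> Q 0}"
    by (rule finite_subset[of _ "Pow M"]) (use indep assms(1) in \<open>blast, simp\<close>)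
  moreover have "{} \<in> {T \<in> \<I> i. T \<subseteq> Q 0}" using indep by simp
  ultimately have "Max (f i ` {T \<in> \<I> i. T \<subseteq> Q 0}) \<in> f i ` {T \<in> \<I> i. T \<subseteq> Q 0}"
    by (intro Max_in) auto
  then obtain T where T: "T \<in> \<I> i" "T \<subseteq> Q 0" and opt: "opt_minus M \<sigma> (f i) (\<I> i) i = f i T"
    unfolding opt_minus_def available_at_first_turn_def Q_def h0 by auto
  have finT: "finite T" using T indep assms(1) finite_subset by blast
  \<comment> \<open>Makes \<open>T - S R\<close> disjoint from every \<open>S k\<close> with
    \<open>k \<le> R\<close>, as counting the items taken by others requires.\<close>
  have S_mono: "S k \<subseteq> S R" if "k \<le> R" for k
    by (rule lift_Suc_mono_le[of S, OF _ that]) (use S_Suc in blast)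
  have "f i T \<le> (real ((n - 1) + 1) + p i) * f i (S R)"
  proof (rule greedy_sequence_bound[where Q = Q and S = S, OF assms(1,3,5-7) S0 _ Q_anti _ _ T])
    show "Q 0 \<subseteq> M" by (auto simp: Q_def available_def)
    show "S (Suc k) = S k" if "{x \<in> Q k. insert x (S k) \<in> \<I> i} = {}" for k
      using greedy[of k] that S_Suc[of k] by (simp add: A_def)
    show "\<exists>g\<in>{x \<in> Q k. insert x (S k) \<in> \<I> i}. S (Suc k) = insert g (S k) \<and>
        (\<forall>x\<in>{x \<in> Q k. insert x (S k) \<in> \<I> i}. f i (insert x (S k)) \<le> f i (insert g (S k)))"
      if "{x \<in> Q k. insert x (S k) \<in> \<I> i} \<noteq> {}" for k
      using greedy[of k] that S_Suc[of k]
      unfolding A_def[symmetric] is_arg_max_linorder marginal_def by auto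
    show "card (T - S R - Q k) \<le> (n - 1) * k" if "k < R" for k
      using card_taken_by_others[OF _ assms(2), of "T - S R" M \<sigma> k] finT T(2) S_mono[of k] that
      unfolding S_def Q_def h_def by auto
    \<comment> \<open>Rounding up in the number of rounds gives \<open>card M \<le> n * R\<close>,
      the \<open>rounds\<close> condition for \<open>c = n - 1\<close>.\<close>
    have "real (card M) / real n \<le> real R" unfolding R_def by linarith
    then have "real (card M) \<le> real (n * R)" using n by (simp add: divide_simps mult.commute)
    then have "card M \<le> n * R" by (simp only: of_nat_le_iff)
    then show "card M \<le> (n - 1 + 1) * R" using n by simp
  qed
  moreover have "real (n - 1 + 1) = real n" using n by simp
  moreover have "0 < real n + p i" using n p_system_nonneg[OF assms(1,7)] by simp
  ultimately show ?thesis
    unfolding opt selected_round_robin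
    by (simp add: S_def R_def h_def pos_divide_le_eq mult.commute)
qed

end
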